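(* For every positive integer $n$, \[ \frac{1}{\sqrt{2}}\, 2^{n/2} \leq r_4(n,2) \leq 1 + \sqrt{2}\cdot 2^{n/2}, \] and consequently $\mu_4(2) = \tfrac{1}{2}$.
   Context: A set $A \subseteq \mathbb{F}_q^n$ with $|A| \ge m$ is called $m$-general (for $3 \le m \le n+2$) if no $m$ points of $A$ lie on a single $(m-2)$-dimensional affine subspace (flat) of $\mathbb{F}_q^n$; equivalently, every $m$-element subset of $A$ is affinely independent. $r_m(n,q)$ denotes the maximum size of an $m$-general set in $\mathbb{F}_q^n$, and $\mu_m(q) = \limsup_{n\to\infty} \frac{\log_q r_m(n,q)}{n}$.
   Formalization: For n = 1, 2 no 4-general set with at least 4 points exists in F_2^n, so r_4(n,2) is undefined; here r_m(n,q) is the maximum size of a set with no m points on an (m-2)-flat, without requiring |A| ≥ m. For n ≥ 3 the value of r_4(n,2) is unchanged. *)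

theory Defs
  imports Complex_Main "HOL-Library.Extended_Real" "HOL-Library.Liminf_Limsup"
    "HOL-Library.Function_Algebras" "HOL-Library.Z2" "HOL-Library.Cardinality"
begin

text \<open>
  The field \<open>\<bbbF>\<^sub>q\<close> is a type \<open>'a :: {field, finite}\<close> with \<open>q = CARD('a)\<close>. Since \<open>n\<close> must be able to
  vary (the growth rate below is a limit superior in \<open>n\<close>), the space \<open>\<bbbF>\<^sub>q\<^sup>n\<close> is the set of all
  sequences vanishing from index \<open>n\<close> on, inside the \<open>\<bbbF>\<^sub>q\<close>-vector space of all sequences.
\<close>

definition seq_scale :: "'a::field \<Rightarrow> (nat \<Rightarrow> 'a) \<Rightarrow> (nat \<Rightarrow> 'a)" where
  "seq_scale c x = (\<lambda>i. c * x i)"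

interpretation seq: vector_space seq_scale
  by standard (simp_all add: seq_scale_def fun_eq_iff algebra_simps)

definition aff_space :: "nat \<Rightarrow> (nat \<Rightarrow> 'a::field) set" where
  "aff_space n = {x. \<forall>i\<ge>n. x i = 0}"

definition flat :: "nat \<Rightarrow> nat \<Rightarrow> (nat \<Rightarrow> 'a::field) set \<Rightarrow> bool" where
  "flat n k E \<longleftrightarrow>
     (\<exists>a \<in> aff_space n. \<exists>W \<subseteq> aff_space n. seq.subspace W \<and> seq.dim W = k \<and> E = (+) a ` W)"

definition no_m_on_flat :: "nat \<Rightarrow> nat \<Rightarrow> (nat \<Rightarrow> 'a::field) set \<Rightarrow> bool" where
  "no_m_on_flat m n A \<longleftrightarrow> (\<nexists>S E. S \<subseteq> A \<and> card S = m \<and> flat n (m - 2) E \<and> S \<subseteq> E)"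

text \<open>Intended for \<open>3 \<le> m \<le> n + 2\<close>.\<close>

definition m_general :: "nat \<Rightarrow> nat \<Rightarrow> (nat \<Rightarrow> 'a::field) set \<Rightarrow> bool" where
  "m_general m n A \<longleftrightarrow> A \<subseteq> aff_space n \<and> card A \<ge> m \<and> no_m_on_flat m n A"

text \<open>
  The maximum ranges over all sets without \<open>m\<close> points on an \<open>(m - 2)\<close>-flat, without the requirement
  \<open>card A \<ge> m\<close>. As soon as some \<open>m\<close>-general set exists, this is the maximum size of an \<open>m\<close>-general
  set (lemma \<open>r_gen_eq_Max_m_general\<close>). In the degenerate cases where none exists (such as \<open>m = 4\<close>
  and \<open>n \<le> 2\<close> over the field with two elements) that maximum would be undefined, whereas \<open>r_gen\<close> is
  then the largest size attained by a set satisfying the condition vacuously.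
\<close>

definition r_gen :: "'a::{field,finite} itself \<Rightarrow> nat \<Rightarrow> nat \<Rightarrow> nat" where
  "r_gen _ m n = Max (card ` {A :: (nat \<Rightarrow> 'a) set. A \<subseteq> aff_space n \<and> no_m_on_flat m n A})"

definition mu_gen :: "'a::{field,finite} itself \<Rightarrow> nat \<Rightarrow> ereal" where
  "mu_gen F m = limsup (\<lambda>n. ereal (log (real CARD('a)) (real (r_gen F m n)) / real n))"

lemma finite_aff_space: "finite (aff_space n :: (nat \<Rightarrow> 'a::{field,finite}) set)"
proof -
  have "finite {f :: nat \<Rightarrow> 'a. \<forall>x. (x \<in> {..<n} \<longrightarrow> f x \<in> UNIV) \<and> (x \<notin> {..<n} \<longrightarrow> f x = 0)}"
    by (rule finite_set_of_finite_funs) simp_all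
  then show ?thesis
    by (simp add: aff_space_def not_less)
qed

lemma r_gen_eq_Max_m_general:
  assumes "\<exists>A :: (nat \<Rightarrow> 'a::{field,finite}) set. m_general m n A"
  shows "r_gen TYPE('a) m n = Max (card ` {A :: (nat \<Rightarrow> 'a) set. m_general m n A})"
proof -
  let ?X = "{A :: (nat \<Rightarrow> 'a) set. A \<subseteq> aff_space n \<and> no_m_on_flat m n A}"
  let ?Y = "{A :: (nat \<Rightarrow> 'a) set. m_general m n A}"
  have fin: "finite ?X"
    by (rule finite_subset[OF _ finite_Pow_iff[THEN iffD2, OF finite_aff_space[of n]]]) blast
  have sub: "?Y \<subseteq> ?X"
    by (auto simp: m_general_def)
  have finY: "finite ?Y"
    using fin sub finite_subset by blast
  obtain B where B: "B \<in> ?Y"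
    using assms by blast
  have "Max (card ` ?X) \<in> card ` ?X"
    using fin B sub by (intro Max_in) auto
  then obtain A where A: "A \<in> ?X" "card A = Max (card ` ?X)"
    by auto
  have "card B \<le> card A"
    unfolding A(2) using fin B sub by (intro Max_ge) auto
  then have "A \<in> ?Y"
    using A(1) B by (auto simp: m_general_def)
  then have "Max (card ` ?X) \<le> Max (card ` ?Y)"
    unfolding A(2)[symmetric] using finY by (intro Max_ge) auto
  moreover have "Max (card ` ?Y) \<le> Max (card ` ?X)"
    using sub fin B by (intro Max_mono) auto
  ultimately show ?thesis
    by (simp add: r_gen_def)
qed

lemma UNIV_bit: "(UNIV :: bit set) = {0, 1}"
  by (auto intro: bit.exhaust)

instance bit :: finite
  by standard (simp add: UNIV_bit)

lemma CARD_bit: "CARD(bit) = 2"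
  by (simp add: UNIV_bit)

end

theory Submission
  imports Defs "HOL-Algebra.Algebraic_Closure_Type" "HOL-Real_Asymp.Real_Asymp"
begin

text \<open>
  A plane over the field with two elements consists of four points with sum zero, so \<open>4\<close>-general
  sets are Sidon sets. The pairwise sums of a Sidon set of size \<open>k\<close> are \<open>k choose 2\<close> distinct
  nonzero vectors, which gives the upper bound. For the lower bound, identify the field \<open>F\<close> with
  \<open>2 ^ m\<close> elements with \<open>\<bbbF>\<^sub>2\<^sup>m\<close>; the graph of \<open>x \<mapsto> x ^ 3\<close> is a Sidon set in \<open>\<bbbF>\<^sub>2\<^sup>2\<^sup>m\<close>, because
  \<open>x + y \<noteq> 0\<close> and \<open>x ^ 3 + y ^ 3\<close> determine \<open>x * y\<close> and hence \<open>{x, y}\<close>.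
\<close>

text \<open>The escape \<open>x = y\<close> is meant for characteristic two, where every sum
  \<open>x + x\<close> is 0.\<close>

definition sidon :: "'a::ab_group_add set \<Rightarrow> bool" where
  "sidon A \<longleftrightarrow> (\<forall>x\<in>A. \<forall>y\<in>A. \<forall>z\<in>A. \<forall>w\<in>A. x + y = z + w \<longrightarrow> x = y \<or> {x, y} = {z, w})"

section \<open>Binary sequences\<close>

lemma bit_seq_add_self [simp]: "x + x = (0 :: nat \<Rightarrow> bit)"
  by (simp add: fun_eq_iff)

lemma bit_seq_diff [simp]: "x - y = (x + y :: nat \<Rightarrow> bit)"
  by (simp add: fun_eq_iff)

lemma bit_seq_add_eq_iff: "x + y = z \<longleftrightarrow> x = (z + y :: nat \<Rightarrow> bit)"
  by (metis bit_seq_diff diff_eq_eq)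

lemma bit_seq_add_eq_0_iff: "x + y = 0 \<longleftrightarrow> x = (y :: nat \<Rightarrow> bit)"
  using bit_seq_add_eq_iff[of x y 0] by simp

lemma seq_scale_bit: "seq_scale c x = (if c = 0 then 0 else x :: nat \<Rightarrow> bit)"
  by (cases c) (auto simp: seq_scale_def fun_eq_iff)

lemma aff_space_add: "x \<in> aff_space n \<Longrightarrow> y \<in> aff_space n \<Longrightarrow> x + y \<in> aff_space n"
  by (simp add: aff_space_def)

lemma zero_in_aff_space [simp]: "0 \<in> aff_space n"
  by (simp add: aff_space_def)

lemma card_aff_space_bit: "card (aff_space n :: (nat \<Rightarrow> bit) set) = 2 ^ n"
proof -
  have "bij_betw (\<lambda>x. {i. x i = 1}) (aff_space n :: (nat \<Rightarrow> bit) set) (Pow {..<n})"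
  proof (rule bij_betw_byWitness[where f' = "\<lambda>S i. of_bool (i \<in> S)"])
    show "\<forall>x\<in>aff_space n. (\<lambda>i. of_bool (i \<in> {i. x i = (1 :: bit)})) = x"
      by (auto simp: fun_eq_iff)
    show "(\<lambda>x. {i. x i = (1 :: bit)}) ` aff_space n \<subseteq> Pow {..<n}"
      by (auto simp: aff_space_def) (metis not_less zero_neq_one)
  qed (auto simp: aff_space_def)
  then show ?thesis
    by (simp add: bij_betw_same_card card_Pow)
qed

section \<open>Planes over the field with two elements\<close>

lemma span_pair_bit: "seq.span {u, v} = {0, u, v, u + v :: nat \<Rightarrow> bit}"
proof
  have "seq.subspace {0, u, v, u + v}"
    by (auto simp: seq.subspace_def seq_scale_bit add.left_commute add.assoc add.commute)
  then show "seq.span {u, v} \<subseteq> {0, u, v, u + v}"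
    by (intro seq.span_minimal) auto
  show "{0, u, v, u + v} \<subseteq> seq.span {u, v}"
    by (auto intro: seq.span_zero seq.span_base seq.span_add)
qed

lemma dim_pair_bit:
  fixes u v :: "nat \<Rightarrow> bit"
  assumes "u \<noteq> 0" "v \<noteq> 0" "u \<noteq> v"
  shows "seq.dim {0, u, v, u + v} = 2"
proof -
  \<comment> \<open>The case \<open>v = u\<close> of the span formula, since
    \<open>u + u = 0\<close>.\<close>
  have "seq.span {u} = {0, u}"
    using span_pair_bit[of u u] by auto
  then have "\<not> seq.dependent {u, v}"
    using assms by (simp add: seq.independent_insert insert_commute[of u v])
  then have "seq.dim {u, v} = 2"
    using assms by (simp add: seq.dim_eq_card_independent)
  then show ?thesis
    by (metis seq.dim_span span_pair_bit)
qed

lemma subspace_dim_2_bit: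
  fixes W :: "(nat \<Rightarrow> bit) set"
  assumes "seq.subspace W" "seq.dim W = 2"
  obtains u v where "W = {0, u, v, u + v}"
proof -
  obtain B where B: "B \<subseteq> W" "W \<subseteq> seq.span B" "card B = 2"
    using seq.basis_exists[of W] assms(2) by metis
  then obtain u v where "B = {u, v}"
    by (meson card_2_iff)
  moreover have "W = seq.span B"
    using B assms(1) by (simp add: seq.span_minimal subset_antisym)
  ultimately show ?thesis
    using that span_pair_bit by metis
qed

text \<open>A failure of the Sidon condition yields four distinct points that form the plane through
  \<open>x\<close> with directions \<open>x + y\<close> and \<open>x + z\<close>. Conversely, four
  points of \<open>A\<close> on a plane exhaust it, and a plane splits into two pairs of equal
  sum.\<close>

lemma no_4_on_flat_iff_sidon:
  fixes A :: "(nat \<Rightarrow> bit) set"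
  assumes "A \<subseteq> aff_space n"
  shows "no_m_on_flat 4 n A \<longleftrightarrow> sidon A"
proof
  assume A: "no_m_on_flat 4 n A"
  show "sidon A"
    unfolding sidon_def
  proof (intro ballI impI, rule ccontr)
    fix x y z w
    assume mem: "x \<in> A" "y \<in> A" "z \<in> A" "w \<in> A" and eq: "x + y = z + w"
      and neq: "\<not> (x = y \<or> {x, y} = {z, w})"
    have w: "w = x + y + z"
      using eq by (metis add.commute bit_seq_add_eq_iff)
    have dist: "x \<noteq> y" "x \<noteq> z" "y \<noteq> z"
      using neq eq by auto
    \<comment> \<open>\<open>w = z\<close> would make the common sum 0 and hence
      \<open>x = y\<close>; the other two coincidences cancel to equal pairs.\<close>
    have dist_w: "w \<noteq> x" "w \<noteq> y" "w \<noteq> z"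
      using neq eq by (auto simp: bit_seq_add_eq_0_iff)
    let ?W = "{0, x + y, x + z, (x + y) + (x + z)}"
    have W4: "(x + y) + (x + z) = y + z"
      by (simp add: fun_eq_iff)
    have "seq.dim ?W = 2"
      using dist by (intro dim_pair_bit) (auto simp: bit_seq_add_eq_iff)
    moreover have "seq.subspace ?W"
      unfolding span_pair_bit[symmetric] by (rule seq.subspace_span)
    moreover have "?W \<subseteq> aff_space n"
      unfolding W4 using mem assms by (auto intro!: aff_space_add)
    ultimately have "flat n 2 ((+) x ` ?W)"
      unfolding flat_def using mem assms by blast
    moreover have "(+) x ` ?W = {x, y, z, w}"
      unfolding W4 by (simp add: w fun_eq_iff add.assoc[symmetric])
    moreover have "card {x, y, z, w} = 4"
      using dist dist_w by auto
    ultimately have "\<not> no_m_on_flat 4 n A"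
      using mem unfolding no_m_on_flat_def by fastforce
    with A show False by simp
  qed
next
  assume A: "sidon A"
  show "no_m_on_flat 4 n A"
    unfolding no_m_on_flat_def
  proof (intro notI, elim exE conjE)
    fix S E
    assume S: "S \<subseteq> A" "card S = 4" "flat n (4 - 2) E" "S \<subseteq> E"
    then obtain a W where "seq.subspace W" "seq.dim W = 2" and E: "E = (+) a ` W"
      by (auto simp: flat_def)
    then obtain u v where W: "W = {0, u, v, u + v}"
      using subspace_dim_2_bit by metis
    have E': "E = {a, a + u, a + v, a + (u + v)}"
      by (simp add: E W)
    \<comment> \<open>The four expressions are not yet known to be distinct; this follows from
      \<open>S = E\<close> because \<open>card S = 4\<close>.\<close>
    have "card E \<le> 4"
      unfolding E' by (simp add: card_insert_if)
    then have "S = E"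
      using S by (intro card_seteq) (auto simp: E')
    then have "card {a, a + u, a + v, a + (u + v)} = 4" "{a, a + u, a + v, a + (u + v)} \<subseteq> A"
      using S E' by auto
    moreover have "a + (a + (u + v)) = (a + u) + (a + v)"
      by (simp add: fun_eq_iff)
    ultimately have "a = a + (u + v) \<or> {a, a + (u + v)} = {a + u, a + v}"
      using A unfolding sidon_def by blast
    \<comment> \<open>Either alternative merges some of the four expressions, leaving at most three
      points.\<close>
    then have "E = {a, a + u, a + v} \<or> E = {a + u, a + v}"
      unfolding E' by auto
    moreover have "card {a, a + u, a + v} \<le> 3" "card {a + u, a + v} \<le> 2"
      by (simp_all add: card_insert_if)
    ultimately show False
      using \<open>S = E\<close> S(2) by auto
  qed
qed

section \<open>The upper bound\<close>

lemma sidon_choose_2_less: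
  fixes A :: "(nat \<Rightarrow> bit) set"
  assumes A: "A \<subseteq> aff_space n" "sidon A"
  shows "card A choose 2 < 2 ^ n"
proof -
  let ?P = "{S. S \<subseteq> A \<and> card S = 2}"
  have finA: "finite A"
    using A(1) finite_aff_space finite_subset by blast
  have sum_pair: "\<Sum>{x, y} = x + y" if "x \<noteq> y" for x y :: "nat \<Rightarrow> bit"
    using that by simp
  have inj: "inj_on (\<lambda>S. \<Sum>x\<in>S. x) ?P"
  proof (rule inj_onI, clarify)
    fix S T
    assume "S \<subseteq> A" "card S = 2" "T \<subseteq> A" "card T = 2" and eq: "\<Sum>S = \<Sum>T"
    then obtain x y z w where ST: "S = {x, y}" "x \<noteq> y" "T = {z, w}" "z \<noteq> w"
      by (meson card_2_iff)
    then have "x + y = z + w"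
      using eq sum_pair by metis
    moreover have "x \<in> A" "y \<in> A" "z \<in> A" "w \<in> A"
      using ST \<open>S \<subseteq> A\<close> \<open>T \<subseteq> A\<close> by auto
    ultimately show "S = T"
      using A(2) ST unfolding sidon_def by blast
  qed
  have img: "(\<lambda>S. \<Sum>x\<in>S. x) ` ?P \<subseteq> aff_space n - {0}"
  proof clarify
    fix S assume "S \<subseteq> A" "card S = 2"
    then obtain x y where xy: "S = {x, y}" "x \<noteq> y"
      by (meson card_2_iff)
    with \<open>S \<subseteq> A\<close> A(1) show "\<Sum>S \<in> aff_space n - {0}"
      by (auto simp: bit_seq_add_eq_iff intro!: aff_space_add)
  qed
  have "card A choose 2 = card ?P"
    using finA by (simp add: n_subsets)
  also have "\<dots> \<le> card (aff_space n - {0} :: (nat \<Rightarrow> bit) set)"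
    using inj img by (rule card_inj_on_le) (simp add: finite_aff_space)
  also have "\<dots> < card (aff_space n :: (nat \<Rightarrow> bit) set)"
    by (intro card_Diff1_less finite_aff_space zero_in_aff_space)
  finally show ?thesis
    by (simp add: card_aff_space_bit)
qed

lemma card_sidon_le:
  fixes A :: "(nat \<Rightarrow> bit) set"
  assumes "A \<subseteq> aff_space n" "sidon A"
  shows "real (card A) \<le> 1 + sqrt 2 * 2 powr (real n / 2)"
proof (cases "card A")
  case (Suc k)
  \<comment> \<open>Weakening \<open>Suc k * k\<close> to \<open>k\<^sup>2\<close> allows a plain
    square root; the summand 1 in the bound is the difference between \<open>card A\<close> and
    \<open>k\<close>.\<close>
  have "k\<^sup>2 \<le> Suc k * k"
    by (simp add: power2_eq_square)
  also have "\<dots> = 2 * (card A choose 2)"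
    by (simp add: Suc choose_two)
  also have "\<dots> \<le> 2 * 2 ^ n"
    using sidon_choose_2_less[OF assms] by simp
  finally have "real (k\<^sup>2) \<le> real (2 * 2 ^ n)"
    by (rule of_nat_mono)
  then have "sqrt ((real k)\<^sup>2) \<le> sqrt (2 * 2 ^ n)"
    by (intro real_sqrt_le_mono) simp
  also have "\<dots> = sqrt 2 * 2 powr (real n / 2)"
    by (simp add: real_sqrt_mult powr_half_sqrt[symmetric] powr_powr flip: powr_realpow)
  finally show ?thesis
    by (simp add: Suc)
qed simp

section \<open>The finite field of order \<open>2 ^ m\<close>\<close>

text \<open>Unlike \<open>rsquarefree_roots\<close>, this does not require characteristic zero.\<close>
lemma rsquarefreeI_pderiv:
  fixes p :: "'a::idom poly"
  assumes "p \<noteq> 0" "\<And>x. poly p x = 0 \<Longrightarrow> poly (pderiv p) x \<noteq> 0"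
  shows "rsquarefree p"
  unfolding rsquarefree_def
proof (intro conjI allI assms(1))
  fix x
  have False if "2 \<le> order x p"
  proof -
    have "[:-x, 1:] ^ 2 dvd p"
      using that by (meson dvd_trans le_imp_power_dvd order_1)
    then obtain q where "p = [:-x, 1:] ^ 2 * q" ..
    then have q: "p = [:-x, 1:] * ([:-x, 1:] * q)"
      by (simp only: power2_eq_square mult.assoc)
    have "poly p x = 0" "poly (pderiv p) x = 0"
      unfolding q pderiv_mult by simp_all
    with assms(2) show False by blast
  qed
  then show "order x p = 0 \<or> order x p = 1"
    by (metis One_nat_def less_2_cases not_less)
qed

text \<open>Over an algebraically closed field the multiset of roots has size
  \<open>degree p\<close>, and squarefreeness makes every multiplicity one.\<close>

lemma card_roots_rsquarefree:
  fixes p :: "'a::alg_closed_field poly"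
  assumes "rsquarefree p"
  shows "card {x. poly p x = 0} = degree p"
proof -
  have "p \<noteq> 0"
    using assms by (simp add: rsquarefree_def)
  then obtain R where R: "size R = degree p" "p = smult (lead_coeff p) (\<Prod>x\<in>#R. [:-x, 1:])"
    using alg_closed_imp_factorization by blast
  have nz: "(\<Prod>x\<in>#S. [:-x, 1:]) \<noteq> 0" for S :: "'a multiset"
    by (auto simp: prod_mset_zero_iff)
  have "proots p = proots (\<Prod>x\<in>#R. [:-x, 1:])"
    using \<open>p \<noteq> 0\<close> by (subst R(2)) simp
  also have "\<dots> = R"
    by (induction R) (simp_all add: proots_mult[OF _ nz] del: mult_pCons_left)
  finally have "size (proots p) = degree p"
    using R(1) by simp
  moreover have "count (proots p) x = 1" if "x \<in> {x. poly p x = 0}" for x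
    using that assms \<open>p \<noteq> 0\<close> by (simp add: rsquarefree_root_order)
  ultimately show ?thesis
    using \<open>p \<noteq> 0\<close> by (simp add: size_multiset_overloaded_eq)
qed

lemma CHAR_bit [simp]: "CHAR(bit) = 2"
  by (rule CHAR_eq_posI) (auto simp: less_2_cases_iff)

text \<open>
  For \<open>m = 0\<close> the set \<open>{0}\<close> takes the role of the field.
\<close>
lemma ex_subring_card_pow_2:
  "\<exists>F :: bit alg_closure set. card F = 2 ^ m \<and> 0 \<in> F \<and>
     (\<forall>x\<in>F. \<forall>y\<in>F. x + y \<in> F \<and> x * y \<in> F)"
proof (cases "m = 0")
  case True
  then show ?thesis
    by (intro exI[of _ "{0}"]) auto
next
  case False
  \<comment> \<open>The roots are the fixed points of the \<open>m\<close>-fold Frobenius map. The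
    derivative is -1 because \<open>2 = 0\<close>, so no root is multiple. For \<open>m = 0\<close>
    the polynomial would be zero.\<close>
  let ?p = "monom 1 (2 ^ m) - [:0, 1:] :: bit alg_closure poly"
  define F where "F = {x :: bit alg_closure. x ^ (2 ^ m) = x}"
  have gt: "(1::nat) < 2 ^ m"
    using False by (intro one_less_power) auto
  have deg: "degree ?p = 2 ^ m"
    unfolding diff_conv_add_uminus using gt
    by (subst degree_add_eq_left) (simp_all add: degree_monom_eq)
  have "(2 :: bit alg_closure) = 0"
    using of_nat_CHAR[where 'a = "bit alg_closure"] by simp
  then have "pderiv ?p = - 1"
    using False by (simp add: pderiv_diff pderiv_monom pderiv_pCons one_pCons power_0_left)
  moreover have "?p \<noteq> 0"
    using deg by force
  ultimately have "rsquarefree ?p"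
    by (intro rsquarefreeI_pderiv) simp_all
  then have "card {x. poly ?p x = 0} = 2 ^ m"
    using card_roots_rsquarefree deg by metis
  moreover have "{x. poly ?p x = 0} = F"
    by (simp add: F_def poly_monom)
  \<comment> \<open>Additivity of Frobenius closes the set of fixed points under sums.\<close>
  moreover have "(x + y) ^ (2 ^ m) = x ^ (2 ^ m) + y ^ (2 ^ m)" for x y :: "bit alg_closure"
    by (rule freshmans_dream') (simp_all add: two_is_prime_nat)
  ultimately show ?thesis
    by (intro exI[of _ F]) (auto simp: F_def power_mult_distrib)
qed

text \<open>\<open>V\<close> is a vector space over the field with two elements, and a basis is
  chosen greedily: while \<open>k < m\<close>, the image of \<open>aff_space k\<close> has fewer
  than \<open>2 ^ m\<close> elements, so some \<open>v\<close> outside it can serve as the next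
  basis vector. At \<open>k = m\<close> counting gives surjectivity.\<close>

lemma ex_additive_bij:
  fixes V :: "'a::ab_group_add set"
  assumes card: "card V = 2 ^ m" and "0 \<in> V"
    and add: "\<And>x y. x \<in> V \<Longrightarrow> y \<in> V \<Longrightarrow> x + y \<in> V"
    and add_self: "\<And>x. x \<in> V \<Longrightarrow> x + x = 0"
  shows "\<exists>\<phi>. bij_betw \<phi> (aff_space m :: (nat \<Rightarrow> bit) set) V \<and>
    (\<forall>x\<in>aff_space m. \<forall>y\<in>aff_space m. \<phi> (x + y) = \<phi> x + \<phi> y)"
proof -
  have fin: "finite V"
    by (rule card_ge_0_finite) (simp add: card)
  have "\<exists>\<phi>. inj_on \<phi> (aff_space k :: (nat \<Rightarrow> bit) set) \<and> \<phi> ` aff_space k \<subseteq> V \<and>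
    (\<forall>x\<in>aff_space k. \<forall>y\<in>aff_space k. \<phi> (x + y) = \<phi> x + \<phi> y)" if "k \<le> m" for k
    using that
  proof (induction k)
    case 0
    have "aff_space 0 = {0 :: nat \<Rightarrow> bit}"
      by (auto simp: aff_space_def)
    then show ?case
      using \<open>0 \<in> V\<close> by (intro exI[of _ "\<lambda>_. 0"]) auto
  next
    case (Suc k)
    then obtain \<phi> where inj: "inj_on \<phi> (aff_space k :: (nat \<Rightarrow> bit) set)"
      and sub: "\<And>x. x \<in> aff_space k \<Longrightarrow> \<phi> x \<in> V"
      and hom: "\<And>x y. x \<in> aff_space k \<Longrightarrow> y \<in> aff_space k \<Longrightarrow> \<phi> (x + y) = \<phi> x + \<phi> y"
      unfolding image_subset_iff by (metis Suc_leD)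
    have "card (\<phi> ` aff_space k) < card V"
      using Suc.prems by (simp add: card_image[OF inj] card_aff_space_bit card)
    then obtain v where v: "v \<in> V" "v \<notin> \<phi> ` aff_space k"
      by (meson card_mono finite_aff_space finite_imageI not_less subsetI)
    \<comment> \<open>The new coordinate \<open>k\<close> is sent to \<open>v\<close>, the lower
      ones go through \<open>\<phi>\<close>.\<close>
    define \<psi> where "\<psi> x = \<phi> (x(k := 0)) + (if x k = 1 then v else 0)" for x
    have trunc: "x(k := 0) \<in> aff_space k" if "x \<in> aff_space (Suc k)" for x :: "nat \<Rightarrow> bit"
      using that by (auto simp: aff_space_def)
    have trunc_add: "(x + y)(k := 0) = x(k := 0) + y(k := 0)" for x y :: "nat \<Rightarrow> bit"
      by (auto simp: fun_eq_iff)
    have hom': "\<psi> (x + y) = \<psi> x + \<psi> y"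
      if "x \<in> aff_space (Suc k)" "y \<in> aff_space (Suc k)" for x y
      using add_self[OF v(1)] hom[OF that[THEN trunc]]
      by (cases "x k"; cases "y k") (simp_all add: \<psi>_def trunc_add algebra_simps)
    have inj': "inj_on \<psi> (aff_space (Suc k))"
    proof (rule inj_onI)
      fix x y :: "nat \<Rightarrow> bit"
      assume mem: "x \<in> aff_space (Suc k)" "y \<in> aff_space (Suc k)" and eq: "\<psi> x = \<psi> y"
      \<comment> \<open>The image of \<open>\<phi>\<close> is closed under addition, so
        \<open>v\<close> cannot join two of its points. Hence \<open>\<psi> x\<close> determines the
        coordinate \<open>x k\<close>.\<close>
      have v_eq: False if "\<phi> a + v = \<phi> b" "a \<in> aff_space k" "b \<in> aff_space k" for a b
      proof -
        have "v = \<phi> a + \<phi> b"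
          using that add_self[OF sub[OF that(2)]] by (metis add.assoc add.left_neutral)
        then show False
          using that v(2) hom aff_space_add by (metis imageI)
      qed
      have "x k = y k"
        using eq v_eq[OF _ trunc[OF mem(1)] trunc[OF mem(2)]]
          v_eq[OF _ trunc[OF mem(2)] trunc[OF mem(1)]]
        by (cases "x k"; cases "y k") (auto simp: \<psi>_def)
      moreover from this have "x(k := 0) = y(k := 0)"
        using eq inj trunc[OF mem(1)] trunc[OF mem(2)]
        by (auto simp: \<psi>_def inj_on_eq_iff split: if_splits)
      ultimately show "x = y"
        by (metis fun_upd_triv fun_upd_upd)
    qed
    have "\<psi> ` aff_space (Suc k) \<subseteq> V"
      using trunc sub v(1) \<open>0 \<in> V\<close> by (auto simp: \<psi>_def intro!: add)
    then show ?case
      using inj' hom' by blast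
  qed
  then obtain \<phi> where \<phi>: "inj_on \<phi> (aff_space m :: (nat \<Rightarrow> bit) set)" "\<phi> ` aff_space m \<subseteq> V"
    "\<forall>x\<in>aff_space m. \<forall>y\<in>aff_space m. \<phi> (x + y) = \<phi> x + \<phi> y"
    by blast
  then have "\<phi> ` aff_space m = V"
    using fin by (intro card_subset_eq) (auto simp: card_image card_aff_space_bit card)
  then show ?thesis
    using \<phi> by (auto simp: bij_betw_def)
qed

section \<open>The graph of the cubing map\<close>

text \<open>The identity \<open>3ab(a + b) = (a + b)^3 - (a^3 + b^3)\<close> recovers the product,
  and a pair is determined by its sum and product.\<close>

lemma pair_eq_if_sum_cubes_eq:
  fixes x y z w :: "'a::field"
  assumes "(3::'a) \<noteq> 0" "x + y \<noteq> 0" "x + y = z + w" "x ^ 3 + y ^ 3 = z ^ 3 + w ^ 3"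
  shows "{x, y} = {z, w}"
proof -
  have cube: "3 * (a * b) * (a + b) = (a + b) ^ 3 - (a ^ 3 + b ^ 3)" for a b :: 'a
    by (simp add: algebra_simps power3_eq_cube)
  have "3 * (x * y) * (x + y) = 3 * (z * w) * (x + y)"
    using cube[of x y] cube[of z w] assms(3,4) by simp
  then have "x * y = z * w"
    using assms(1,2) by simp
  \<comment> \<open>Expanding and replacing \<open>z * w\<close> by \<open>x * y\<close>; the right
    side vanishes because the sums agree.\<close>
  then have "(x - z) * (x - w) = x * (x + y) - x * (z + w)"
    by (simp add: algebra_simps)
  then have "x = z \<or> x = w"
    using assms(3) by simp
  then show ?thesis
    using assms(3) by auto
qed

text \<open>The graph has as many points as the square root of the size of the space, which matches
  the upper bound up to a constant.\<close>

lemma ex_sidon_card_pow_2: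
  "\<exists>A :: (nat \<Rightarrow> bit) set. A \<subseteq> aff_space (2 * m) \<and> sidon A \<and> card A = 2 ^ m"
proof -
  obtain F :: "bit alg_closure set" where F: "card F = 2 ^ m" "0 \<in> F"
    "\<And>x y. x \<in> F \<Longrightarrow> y \<in> F \<Longrightarrow> x + y \<in> F" "\<And>x y. x \<in> F \<Longrightarrow> y \<in> F \<Longrightarrow> x * y \<in> F"
    using ex_subring_card_pow_2[of m] by blast
  have two: "(2 :: bit alg_closure) = 0"
    using of_nat_CHAR[where 'a = "bit alg_closure"] by simp
  then have add_self: "x + x = 0" for x :: "bit alg_closure"
    by (metis mult_2 mult_zero_left)
  \<comment> \<open>In characteristic two, 3 equals 1, so the factor 3 in the cube identity can be
    cancelled.\<close>
  have "(3 :: bit alg_closure) = 2 + 1"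
    by simp
  then have three: "(3 :: bit alg_closure) \<noteq> 0"
    unfolding two by simp
  let ?V = "aff_space m :: (nat \<Rightarrow> bit) set"
  obtain \<phi> where bij: "bij_betw \<phi> ?V F"
    and hom: "\<And>x y. x \<in> ?V \<Longrightarrow> y \<in> ?V \<Longrightarrow> \<phi> (x + y) = \<phi> x + \<phi> y"
    using ex_additive_bij[OF F(1-3) add_self] by blast
  \<comment> \<open>Cubing, transported to bit sequences along \<open>\<phi>\<close>.\<close>
  define c where "c x = inv_into ?V \<phi> (\<phi> x ^ 3)" for x
  have cube: "\<phi> x ^ 3 \<in> F" if "x \<in> ?V" for x
    using that bij F(4) by (auto simp: power3_eq_cube bij_betw_def)
  have c_mem: "c x \<in> ?V" if "x \<in> ?V" for x
    using cube[OF that] bij by (metis c_def bij_betw_def inv_into_into)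
  have \<phi>_c: "\<phi> (c x) = \<phi> x ^ 3" if "x \<in> ?V" for x
    using cube[OF that] bij by (simp add: c_def bij_betw_inv_into_right)
  \<comment> \<open>The point of the graph over \<open>x\<close>: entries below \<open>m\<close>
    hold \<open>x\<close>, the next \<open>m\<close> hold its cube.\<close>
  define g where "g x = (\<lambda>i. if i < m then x i else c x (i - m))" for x
  have g_mem: "g x \<in> aff_space (2 * m)" if "x \<in> ?V" for x
    using c_mem[OF that] by (auto simp: g_def aff_space_def)
  have g_eqD: "x + y = z + w \<and> c x + c y = c z + c w"
    if "g x + g y = g z + g w" and mem: "x \<in> ?V" "y \<in> ?V" "z \<in> ?V" "w \<in> ?V" for x y z w
  proof (intro conjI ext)
    fix i
    have *: "g x j + g y j = g z j + g w j" for j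
      using that(1) by (metis plus_fun_apply)
    show "(x + y) i = (z + w) i"
      using *[of i] mem by (cases "i < m") (simp_all add: g_def aff_space_def)
    show "(c x + c y) i = (c z + c w) i"
      using *[of "m + i"] by (simp add: g_def)
  qed
  have inj: "inj_on g ?V"
  proof (rule inj_onI)
    fix x y assume mem: "x \<in> ?V" "y \<in> ?V" and eq: "g x = g y"
    \<comment> \<open>Injectivity is obtained from \<open>g_eqD\<close> by adding \<open>g 0\<close>
      to both sides.\<close>
    have "x + 0 = y + 0"
      using g_eqD[of x 0 y 0] mem eq by simp
    then show "x = y" by simp
  qed
  have "sidon (g ` ?V)"
    unfolding sidon_def
  proof (clarify)
    fix x y z w
    assume mem: "x \<in> ?V" "y \<in> ?V" "z \<in> ?V" "w \<in> ?V" and eq: "g x + g y = g z + g w"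
      and neq: "{g x, g y} \<noteq> {g z, g w}"
    have sum: "\<phi> x + \<phi> y = \<phi> z + \<phi> w"
      using g_eqD[OF eq mem] mem hom by metis
    have "\<phi> (c x) + \<phi> (c y) = \<phi> (c z) + \<phi> (c w)"
      using g_eqD[OF eq mem] mem hom c_mem by metis
    then have "\<phi> x ^ 3 + \<phi> y ^ 3 = \<phi> z ^ 3 + \<phi> w ^ 3"
      using mem by (simp add: \<phi>_c)
    moreover have "\<phi> ` {x, y} \<noteq> \<phi> ` {z, w}"
      using neq mem bij inj_on_image_eq_iff[of \<phi> ?V "{x, y}" "{z, w}"]
      by (auto simp: bij_betw_def)
    \<comment> \<open>A nonzero sum would force equal pairs, so only the exception
      \<open>x = y\<close> remains.\<close>
    ultimately have "\<phi> x + \<phi> y = 0"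
      using pair_eq_if_sum_cubes_eq[OF three _ sum] by auto
    then have "\<phi> x = \<phi> y"
      using add_self by (metis add_left_cancel)
    then show "g x = g y"
      using bij mem by (metis bij_betw_def inj_onD)
  qed
  moreover have "card (g ` ?V) = 2 ^ m"
    by (simp add: card_image inj card_aff_space_bit)
  ultimately show ?thesis
    using g_mem by (intro exI[of _ "g ` ?V"]) auto
qed

section \<open>The maximal size of a Sidon set\<close>

lemma r_gen_bit_4:
  "r_gen TYPE(bit) 4 n = Max (card ` {A :: (nat \<Rightarrow> bit) set. A \<subseteq> aff_space n \<and> sidon A})"
  unfolding r_gen_def using no_4_on_flat_iff_sidon
  by (intro arg_cong[where f = "\<lambda>\<A>. Max (card ` \<A>)"]) auto

lemma finite_sidon_sets: "finite {A :: (nat \<Rightarrow> bit) set. A \<subseteq> aff_space n \<and> sidon A}"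
  by (rule finite_subset[of _ "Pow (aff_space n)"]) (auto simp: finite_aff_space)

lemma r_gen_bit_4_le: "real (r_gen TYPE(bit) 4 n) \<le> 1 + sqrt 2 * 2 powr (real n / 2)"
proof -
  \<comment> \<open>The empty set makes the family nonempty, so the maximum is attained.\<close>
  have "{} \<in> {A :: (nat \<Rightarrow> bit) set. A \<subseteq> aff_space n \<and> sidon A}"
    by (simp add: sidon_def)
  then have "r_gen TYPE(bit) 4 n \<in> card ` {A :: (nat \<Rightarrow> bit) set. A \<subseteq> aff_space n \<and> sidon A}"
    unfolding r_gen_bit_4 by (intro Max_in finite_imageI finite_sidon_sets) blast
  then show ?thesis
    using card_sidon_le by auto
qed

text \<open>The construction lives in even dimension \<open>2 * (n div 2)\<close>. For odd
  \<open>n\<close> one dimension is given up, which costs the factor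
  \<open>1 / sqrt 2\<close>.\<close>

lemma r_gen_bit_4_ge: "1 / sqrt 2 * 2 powr (real n / 2) \<le> real (r_gen TYPE(bit) 4 n)"
proof -
  obtain A :: "(nat \<Rightarrow> bit) set"
    where A: "A \<subseteq> aff_space (2 * (n div 2))" "sidon A" "card A = 2 ^ (n div 2)"
    using ex_sidon_card_pow_2 by blast
  have "aff_space (2 * (n div 2)) \<subseteq> (aff_space n :: (nat \<Rightarrow> bit) set)"
    by (auto simp: aff_space_def)
  then have "A \<in> {A. A \<subseteq> aff_space n \<and> sidon A}"
    using A by blast
  then have "card A \<le> r_gen TYPE(bit) 4 n"
    unfolding r_gen_bit_4 by (intro Max_ge finite_imageI finite_sidon_sets imageI)
  then have le: "2 powr real (n div 2) \<le> real (r_gen TYPE(bit) 4 n)"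
    by (simp add: A(3) powr_realpow flip: of_nat_le_iff)
  have "1 / sqrt 2 * 2 powr (real n / 2) = 2 powr (real n / 2 - 1 / 2)"
    by (simp add: powr_diff powr_half_sqrt)
  also have "\<dots> \<le> 2 powr real (n div 2)"
    by (intro powr_mono) linarith+
  finally show ?thesis
    using le by linarith
qed

theorem theorem5p1:
  shows "(\<forall>n::nat. n > 0 \<longrightarrow>
            1 / sqrt 2 * 2 powr (real n / 2) \<le> real (r_gen TYPE(bit) 4 n) \<and>
            real (r_gen TYPE(bit) 4 n) \<le> 1 + sqrt 2 * 2 powr (real n / 2)) \<and>
         mu_gen TYPE(bit) 4 = 1 / 2"
proof (intro conjI)
  show "\<forall>n::nat. n > 0 \<longrightarrow>
            1 / sqrt 2 * 2 powr (real n / 2) \<le> real (r_gen TYPE(bit) 4 n) \<and>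
            real (r_gen TYPE(bit) 4 n) \<le> 1 + sqrt 2 * 2 powr (real n / 2)"
    using r_gen_bit_4_le r_gen_bit_4_ge by blast
  \<comment> \<open>This includes \<open>n = 0\<close>, where all the quotients are 0 by
    convention.\<close>
  have mono: "log 2 (1 / sqrt 2 * 2 powr (real n / 2)) / n \<le> log 2 (r_gen TYPE(bit) 4 n) / n \<and>
      log 2 (r_gen TYPE(bit) 4 n) / n \<le> log 2 (1 + sqrt 2 * 2 powr (real n / 2)) / n" for n
  proof -
    have pos: "0 < 1 / sqrt 2 * 2 powr (real n / 2)"
      by simp
    moreover from this have "0 < real (r_gen TYPE(bit) 4 n)"
      using r_gen_bit_4_ge[of n] by linarith
    ultimately show ?thesis
      by (intro conjI divide_right_mono log_mono r_gen_bit_4_ge r_gen_bit_4_le) simp_all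
  qed
  \<comment> \<open>Both bounds have binary logarithm \<open>n / 2\<close> up to a bounded error, so
    the limit superior is an actual limit.\<close>
  have "(\<lambda>n. log 2 (r_gen TYPE(bit) 4 n) / n) \<longlonglongrightarrow> 1 / 2"
  proof (rule tendsto_sandwich)
    show "(\<lambda>n. log 2 (1 / sqrt 2 * 2 powr (real n / 2)) / n) \<longlonglongrightarrow> 1 / 2"
      by real_asymp
    show "(\<lambda>n. log 2 (1 + sqrt 2 * 2 powr (real n / 2)) / n) \<longlonglongrightarrow> 1 / 2"
      by real_asymp
  qed (use mono in auto)
  then have "(\<lambda>n. ereal (log (real CARD(bit)) (r_gen TYPE(bit) 4 n) / n)) \<longlonglongrightarrow> ereal (1 / 2)"
    by (simp add: CARD_bit)
  then have "mu_gen TYPE(bit) 4 = ereal (1 / 2)"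
    unfolding mu_gen_def by (intro lim_imp_Limsup) auto
  then show "mu_gen TYPE(bit) 4 = 1 / 2"
    by (simp add: one_ereal_def)
qed

end
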